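(* Let $G$ be a non-empty closed subset of the Grassmannian $G(p,\mathbb{R}^n)$, $1\le p\le n$, and let $X\subset\mathbb{R}^n$ be a connected open set. Suppose $M\subset X$ is a $G$-submanifold which is minimal. Then for each $u\in C^\infty(X)$ which is $G$-plurisubharmonic, the restriction of $u$ to $M$ is subharmonic in the induced Riemannian metric on $M$.
   Context: $G(p,\mathbb{R}^n)$ is the Grassmannian of unoriented $p$-planes through the origin in $\mathbb{R}^n$; $P_\xi$ denotes orthogonal projection of $\mathbb{R}^n$ onto $\xi\in G(p,\mathbb{R}^n)$. For a quadratic form (symmetric matrix) $A$ on $\mathbb{R}^n$, $\mathrm{tr}_\xi A=\mathrm{tr}(AP_\xi)=\mathrm{tr}(A|_\xi)$. A function $u\in C^\infty(X)$ is $G$-plurisubharmonic if $\mathrm{tr}_\xi(\mathrm{Hess}_xu)\ge0$ for all $\xi\in G$ and all $x\in X$. A $G$-submanifold is a $p$-dimensional submanifold $M$ with $T_xM\in G$ for every $x\in M$. Minimal means vanishing mean curvature. A smooth function $h$ on $M$ is subharmonic if $\Delta_Mh\ge0$, where $\Delta_M$ is the Laplace–Beltrami operator of the induced metric. *)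

theory Defs
  imports "HOL-Analysis.Analysis"
begin

text \<open>Smoothness on open sets; \<^term>\<open>frechet_derivative f (at x) v\<close> is the derivative of \<open>f\<close>
  at \<open>x\<close> in direction \<open>v\<close>. The predicates are meaningful only for open \<open>S\<close>.\<close>

fun Ck_on :: "nat \<Rightarrow> 'a::real_normed_vector set \<Rightarrow> ('a \<Rightarrow> 'b::real_normed_vector) \<Rightarrow> bool" where
  "Ck_on 0 S f \<longleftrightarrow> continuous_on S f"
| "Ck_on (Suc k) S f \<longleftrightarrow>
     (\<forall>x\<in>S. f differentiable (at x)) \<and>
     (\<forall>v. Ck_on k S (\<lambda>x. frechet_derivative f (at x) v))"

definition smooth_on :: "'a::real_normed_vector set \<Rightarrow> ('a \<Rightarrow> 'b::real_normed_vector) \<Rightarrow> bool" where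
  "smooth_on S f \<longleftrightarrow> (\<forall>k. Ck_on k S f)"

definition pd :: "'m::finite \<Rightarrow> (real^'m \<Rightarrow> 'b::real_normed_vector) \<Rightarrow> real^'m \<Rightarrow> 'b" where
  "pd i f x = frechet_derivative f (at x) (axis i 1)"

definition hess :: "(real^'n \<Rightarrow> real) \<Rightarrow> real^'n \<Rightarrow> real^'n^'n" where
  "hess u x = (\<chi> i j. pd i (pd j u) x)"

definition orth_proj :: "(real^'n) set \<Rightarrow> real^'n \<Rightarrow> real^'n" where
  "orth_proj V x = (THE y. y \<in> V \<and> (\<forall>v\<in>V. orthogonal (x - y) v))"

definition grassmannian :: "nat \<Rightarrow> (real^'n) set set" where
  "grassmannian p = {V. subspace V \<and> dim V = p}"

text \<open>The usual topology of the Grassmannian, induced by the embedding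
  \<open>\<xi> \<mapsto> P\<^sub>\<xi>\<close> into the space of matrices.\<close>

definition grassmannian_topology :: "nat \<Rightarrow> (real^'n) set topology" where
  "grassmannian_topology p =
     pullback_topology (grassmannian p) (\<lambda>V. matrix (orth_proj V)) euclidean"

definition tr_on :: "(real^'n) set \<Rightarrow> real^'n^'n \<Rightarrow> real" where
  "tr_on \<xi> A = trace (A ** matrix (orth_proj \<xi>))"

definition G_psh_on :: "(real^'n) set set \<Rightarrow> (real^'n) set \<Rightarrow> (real^'n \<Rightarrow> real) \<Rightarrow> bool" where
  "G_psh_on G X u \<longleftrightarrow> smooth_on X u \<and> (\<forall>x\<in>X. \<forall>\<xi>\<in>G. tr_on \<xi> (hess u x) \<ge> 0)"

text \<open>Smooth embedded submanifolds of \<open>\<real>\<^sup>n\<close> of dimension \<open>CARD('p)\<close>, described by local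
  parametrizations: smooth immersions of open sets \<open>W\<close> that are homeomorphisms onto relatively
  open subsets of \<open>M\<close>. The dimension is passed as a type argument.\<close>

definition local_parametrization ::
    "(real^'n) set \<Rightarrow> (real^'p) set \<Rightarrow> (real^'p \<Rightarrow> real^'n) \<Rightarrow> bool" where
  "local_parametrization M W \<phi> \<longleftrightarrow>
     open W \<and> smooth_on W \<phi> \<and>
     (\<forall>w\<in>W. inj (frechet_derivative \<phi> (at w))) \<and>
     openin (top_of_set M) (\<phi> ` W) \<and>
     (\<exists>\<psi>. homeomorphism W (\<phi> ` W) \<phi> \<psi>)"

definition submanifold :: "'p::finite itself \<Rightarrow> (real^'n) set \<Rightarrow> bool" where
  "submanifold _ M \<longleftrightarrow>
     (\<forall>x\<in>M. \<exists>W (\<phi> :: real^'p \<Rightarrow> real^'n). local_parametrization M W \<phi> \<and> x \<in> \<phi> ` W)"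

text \<open>Velocities at \<open>x\<close> of smooth curves in \<open>M\<close>.\<close>

definition tangent_space :: "(real^'n) set \<Rightarrow> real^'n \<Rightarrow> (real^'n) set" where
  "tangent_space M x =
     {v. \<exists>\<gamma> \<epsilon>. \<epsilon> > (0::real) \<and> smooth_on {-\<epsilon><..<\<epsilon>} \<gamma> \<and> \<gamma> ` {-\<epsilon><..<\<epsilon>} \<subseteq> M \<and>
        \<gamma> 0 = x \<and> (\<gamma> has_vector_derivative v) (at 0)}"

definition G_submanifold :: "'p::finite itself \<Rightarrow> (real^'n) set set \<Rightarrow> (real^'n) set \<Rightarrow> bool" where
  "G_submanifold P G M \<longleftrightarrow> submanifold P M \<and> (\<forall>x\<in>M. tangent_space M x \<in> G)"

definition induced_metric :: "(real^'p \<Rightarrow> real^'n) \<Rightarrow> real^'p \<Rightarrow> real^'p^'p" where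
  "induced_metric \<phi> w = (\<chi> i j. pd i \<phi> w \<bullet> pd j \<phi> w)"

text \<open>Value of the second fundamental form on the coordinate fields \<open>i\<close> and \<open>j\<close>: the component of
  \<open>\<partial>\<^sub>i \<partial>\<^sub>j \<phi>\<close> normal to \<open>M\<close>. The mean curvature vector is its trace with respect to the induced
  metric (without the factor \<open>1/p\<close> used by some authors).\<close>

definition second_fundamental_form ::
    "(real^'n) set \<Rightarrow> (real^'p \<Rightarrow> real^'n) \<Rightarrow> real^'p \<Rightarrow> 'p \<Rightarrow> 'p \<Rightarrow> real^'n" where
  "second_fundamental_form M \<phi> w i j =
     pd i (pd j \<phi>) w - orth_proj (tangent_space M (\<phi> w)) (pd i (pd j \<phi>) w)"

definition mean_curvature ::
    "(real^'n) set \<Rightarrow> (real^'p \<Rightarrow> real^'n) \<Rightarrow> real^'p \<Rightarrow> real^'n" where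
  "mean_curvature M \<phi> w =
     (\<Sum>i\<in>UNIV. \<Sum>j\<in>UNIV.
        matrix_inv (induced_metric \<phi> w) $ i $ j *\<^sub>R second_fundamental_form M \<phi> w i j)"

definition minimal_submanifold :: "'p::finite itself \<Rightarrow> (real^'n) set \<Rightarrow> bool" where
  "minimal_submanifold P M \<longleftrightarrow>
     submanifold P M \<and>
     (\<forall>W (\<phi> :: real^'p \<Rightarrow> real^'n). local_parametrization M W \<phi> \<longrightarrow>
        (\<forall>w\<in>W. mean_curvature M \<phi> w = 0))"

text \<open>The coordinate expression
  \<open>\<Delta>f = \<bar>g\<bar>\<^sup>-\<^sup>1\<^sup>/\<^sup>2 \<Sum>\<^sub>i \<partial>\<^sub>i (\<bar>g\<bar>\<^sup>1\<^sup>/\<^sup>2 \<Sum>\<^sub>j g\<^sup>i\<^sup>j \<partial>\<^sub>j f)\<close> of \<open>div grad f\<close> for a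
  Riemannian metric \<open>g\<close>.\<close>

definition laplace_beltrami ::
    "(real^'p \<Rightarrow> real^'p^'p) \<Rightarrow> (real^'p \<Rightarrow> real) \<Rightarrow> real^'p \<Rightarrow> real" where
  "laplace_beltrami g f w =
     1 / sqrt (det (g w)) *
     (\<Sum>i\<in>UNIV. pd i (\<lambda>z. sqrt (det (g z)) * (\<Sum>j\<in>UNIV. matrix_inv (g z) $ i $ j * pd j f z)) w)"

text \<open>Only the values of \<open>h\<close> on \<open>M\<close> matter here.\<close>

definition subharmonic_on_submanifold ::
    "'p::finite itself \<Rightarrow> (real^'n) set \<Rightarrow> (real^'n \<Rightarrow> real) \<Rightarrow> bool" where
  "subharmonic_on_submanifold _ M h \<longleftrightarrow>
     (\<forall>W (\<phi> :: real^'p \<Rightarrow> real^'n). local_parametrization M W \<phi> \<longrightarrow>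
        smooth_on W (h \<circ> \<phi>) \<and>
        (\<forall>w\<in>W. laplace_beltrami (induced_metric \<phi>) (h \<circ> \<phi>) w \<ge> 0))"

end

theory Submission
  imports Defs
begin

text \<open>Let \<open>\<phi>\<close> parametrize a piece of \<open>M\<close>, with coordinate vectors \<open>e\<^sub>i = \<partial>\<^sub>i \<phi>\<close>, Gram matrix
  \<open>g\<^sub>i\<^sub>j = e\<^sub>i \<bullet> e\<^sub>j\<close> and tangent space \<open>T = span {e\<^sub>i}\<close>. The theorem is a consequence of the identity
  \<open>\<Delta>\<^sub>M u = tr\<^sub>T (Hess u) + \<nabla>u \<bullet> H\<close>, where \<open>H\<close> is the mean curvature vector: minimality kills
  the second term, and the first is nonnegative because \<open>T\<close> belongs to \<open>G\<close> and \<open>u\<close> is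
  \<open>G\<close>-plurisubharmonic.

  The identity is \<open>laplace_beltrami_compose\<close>. The gradient of \<open>u \<circ> \<phi>\<close> is the vector field \<open>Y\<close>
  solving \<open>\<Sum>\<^sub>k g\<^sub>j\<^sub>k Y\<^sub>k = \<nabla>u \<bullet> e\<^sub>j\<close>, so \<open>\<Sum>\<^sub>k Y\<^sub>k e\<^sub>k\<close> is the orthogonal projection of \<open>\<nabla>u\<close> to
  \<open>T\<close>. Its divergence is \<open>\<Sum>\<^sub>i \<partial>\<^sub>i Y\<^sub>i\<close> plus half the logarithmic derivative of \<open>det g\<close> along \<open>Y\<close>,
  which the formula of Jacobi for the derivative of a determinant expresses through \<open>\<partial>\<^sub>i g\<close>
  (\<open>divergence_formula\<close>). The derivatives \<open>\<partial>\<^sub>i Y\<^sub>k\<close> are never computed from a formula for the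
  inverse of \<open>g\<close>: differentiating the equation that defines \<open>Y\<close> and contracting with the
  inverse of \<open>g\<close> produces \<open>\<Sum>\<^sub>i \<partial>\<^sub>i Y\<^sub>i\<close> directly, together with the terms that cancel the
  logarithmic derivative and leave \<open>(\<nabla>u - P\<^sub>T \<nabla>u) \<bullet> \<Sum>\<^sub>i\<^sub>j g\<^sup>i\<^sup>j \<partial>\<^sub>i \<partial>\<^sub>j \<phi>\<close>
  (\<open>divergence_contraction\<close>). Since \<open>P\<^sub>T\<close> is self-adjoint, this is \<open>\<nabla>u \<bullet> H\<close>. The cancellation
  uses \<open>\<partial>\<^sub>i \<partial>\<^sub>j \<phi> = \<partial>\<^sub>j \<partial>\<^sub>i \<phi>\<close>, which is proved here from the mean value theorem.

  The tangent space of the theorem consists of velocities of curves in \<open>M\<close>. It contains the range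
  of the derivative of \<open>\<phi>\<close>, and since a closed set \<open>G\<close> consists of \<open>p\<close>-planes, the two subspaces
  have the same dimension and coincide; no inverse of \<open>\<phi>\<close> has to be differentiated.\<close>

section \<open>Calculus of functions of class \<open>C\<^sup>k\<close>\<close>

lemma Ck_on_SucD: "Ck_on (Suc k) S f \<Longrightarrow> Ck_on k S f"
proof (induction k arbitrary: f)
  case 0
  then have "\<forall>x\<in>S. f differentiable (at x)" by simp
  then have "f differentiable_on S"
    unfolding differentiable_on_def by (blast intro: differentiable_at_withinI)
  then show ?case
    by (simp only: Ck_on.simps differentiable_imp_continuous_on)
next
  case (Suc k)
  show ?case
    unfolding Ck_on.simps(2)[of k]
  proof (intro conjI allI)
    show "\<forall>x\<in>S. f differentiable (at x)"
      using Suc.prems by simp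
    fix v
    have "Ck_on (Suc k) S (\<lambda>x. frechet_derivative f (at x) v)"
      using Suc.prems by (simp only: Ck_on.simps(2)[of "Suc k"])
    then show "Ck_on k S (\<lambda>x. frechet_derivative f (at x) v)"
      by (rule Suc.IH)
  qed
qed

text \<open>The predicate refers to derivatives in the whole space, which depend on values near a
  point only; this is where openness of \<open>S\<close> enters.\<close>

lemma Ck_on_cong:
  assumes "open S" "\<And>x. x \<in> S \<Longrightarrow> f x = g x" "Ck_on k S f"
  shows "Ck_on k S g"
  using assms(2,3)
proof (induction k arbitrary: f g)
  case 0
  have "continuous_on S f \<longleftrightarrow> continuous_on S g"
    by (rule continuous_on_cong[OF refl 0(1)])
  then show ?case
    using 0(2) by (simp only: Ck_on.simps)
next
  case (Suc k)
  have f: "f differentiable (at x)" if "x \<in> S" for x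
    using Suc.prems(2) that by simp
  have diff: "g differentiable (at x)" if x: "x \<in> S" for x
  proof -
    obtain D where "(f has_derivative D) (at x)"
      using f[OF x] by (auto simp: differentiable_def)
    then have "(g has_derivative D) (at x)"
      by (rule has_derivative_transform_within_open[OF _ assms(1) x]) (rule Suc.prems(1))
    then show ?thesis
      by (rule differentiableI)
  qed
  have eq: "frechet_derivative f (at x) = frechet_derivative g (at x)" if "x \<in> S" for x
    by (rule frechet_derivative_transform_within_open[OF f[OF that] assms(1) that Suc.prems(1)])
  have "Ck_on k S (\<lambda>x. frechet_derivative g (at x) v)" for v
  proof (rule Suc.IH)
    show "frechet_derivative f (at x) v = frechet_derivative g (at x) v" if "x \<in> S" for x
      by (simp only: eq[OF that])
    show "Ck_on k S (\<lambda>x. frechet_derivative f (at x) v)"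
      using Suc.prems(2) by simp
  qed
  with diff show ?case by simp
qed

lemma Ck_on_SucI:
  assumes "open S" "\<And>x. x \<in> S \<Longrightarrow> (f has_derivative f' x) (at x)"
    and "\<And>v. Ck_on k S (\<lambda>x. f' x v)"
  shows "Ck_on (Suc k) S f"
proof -
  have "Ck_on k S (\<lambda>x. frechet_derivative f (at x) v)" for v
  proof (rule Ck_on_cong[OF \<open>open S\<close> _ assms(3)[of v]])
    show "f' x v = frechet_derivative f (at x) v" if "x \<in> S" for x
      using frechet_derivative_at[OF assms(2)[OF that]] by simp
  qed
  then show ?thesis
    using assms(2) by (auto simp: differentiable_def)
qed

lemma Ck_on_Suc_has_derivative:
  assumes "Ck_on (Suc k) S f" "x \<in> S"
  shows "(f has_derivative frechet_derivative f (at x)) (at x)"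
  using assms by (simp add: frechet_derivative_works)

lemma Ck_on_const: "open S \<Longrightarrow> Ck_on k S (\<lambda>x. c)"
  by (induction k arbitrary: c) auto

lemma Ck_on_bounded_linear_compose:
  assumes "open S" "bounded_linear L" "Ck_on k S f"
  shows "Ck_on k S (\<lambda>x. L (f x))"
  using assms(3)
proof (induction k arbitrary: f)
  case 0
  then show ?case
    using bounded_linear.continuous_on[OF assms(2)] by simp
next
  case (Suc k)
  show ?case
  proof (rule Ck_on_SucI[OF assms(1)])
    show "((\<lambda>x. L (f x)) has_derivative (\<lambda>v. L (frechet_derivative f (at x) v))) (at x)"
      if "x \<in> S" for x
      by (rule bounded_linear.has_derivative[OF assms(2) Ck_on_Suc_has_derivative[OF Suc.prems that]])
    show "Ck_on k S (\<lambda>x. L (frechet_derivative f (at x) v))" for v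
      using Suc by simp
  qed
qed

lemma Ck_on_add:
  assumes "open S" "Ck_on k S f" "Ck_on k S g"
  shows "Ck_on k S (\<lambda>x. f x + g x)"
  using assms(2,3)
proof (induction k arbitrary: f g)
  case 0
  then show ?case by (simp add: continuous_on_add)
next
  case (Suc k)
  show ?case
  proof (rule Ck_on_SucI[OF assms(1)])
    show "((\<lambda>x. f x + g x) has_derivative
        (\<lambda>v. frechet_derivative f (at x) v + frechet_derivative g (at x) v)) (at x)"
      if "x \<in> S" for x
      using Ck_on_Suc_has_derivative[OF Suc.prems(1) that] Ck_on_Suc_has_derivative[OF Suc.prems(2) that]
      by (rule has_derivative_add)
    show "Ck_on k S (\<lambda>x. frechet_derivative f (at x) v + frechet_derivative g (at x) v)" for v
      using Suc by simp
  qed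
qed

lemma Ck_on_sum:
  assumes "open S" "finite I" "\<And>i. i \<in> I \<Longrightarrow> Ck_on k S (f i)"
  shows "Ck_on k S (\<lambda>x. \<Sum>i\<in>I. f i x)"
  using assms(2,3) by (induction I) (auto intro!: Ck_on_const Ck_on_add assms(1))

lemma Ck_on_scaleR:
  fixes a :: "'a::real_normed_vector \<Rightarrow> real"
  assumes "open S" "Ck_on k S a" "Ck_on k S f"
  shows "Ck_on k S (\<lambda>x. a x *\<^sub>R f x)"
  using assms(2,3)
proof (induction k arbitrary: a f)
  case 0
  then show ?case by (simp add: continuous_on_scaleR)
next
  case (Suc k)
  show ?case
  proof (rule Ck_on_SucI[OF assms(1)])
    show "((\<lambda>x. a x *\<^sub>R f x) has_derivative
        (\<lambda>v. a x *\<^sub>R frechet_derivative f (at x) v + frechet_derivative a (at x) v *\<^sub>R f x)) (at x)"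
      if "x \<in> S" for x
      using Ck_on_Suc_has_derivative[OF Suc.prems(1) that] Ck_on_Suc_has_derivative[OF Suc.prems(2) that]
      by (rule has_derivative_scaleR)
    show "Ck_on k S (\<lambda>x. a x *\<^sub>R frechet_derivative f (at x) v + frechet_derivative a (at x) v *\<^sub>R f x)" for v
    proof (rule Ck_on_add[OF assms(1)]; rule Suc.IH)
      show "Ck_on k S a" "Ck_on k S f"
        using Ck_on_SucD[OF Suc.prems(1)] Ck_on_SucD[OF Suc.prems(2)] .
      show "Ck_on k S (\<lambda>x. frechet_derivative a (at x) v)" "Ck_on k S (\<lambda>x. frechet_derivative f (at x) v)"
        using Suc.prems by simp_all
    qed
  qed
qed

text \<open>The derivative of \<open>g \<circ> f\<close> is expanded in coordinates of the middle space: it becomes a sum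
  of products of a component of the derivative of \<open>f\<close> and a directional derivative of \<open>g\<close> in a fixed
  direction, composed with \<open>f\<close>, so that sums, products and the induction hypothesis suffice. This is
  why the middle space is Euclidean.\<close>

lemma Ck_on_compose:
  fixes f :: "'a::real_normed_vector \<Rightarrow> 'b::euclidean_space"
  assumes "open S" "Ck_on k S f" "f ` S \<subseteq> T" "Ck_on k T g"
  shows "Ck_on k S (g \<circ> f)"
  using assms(2,4)
proof (induction k arbitrary: g)
  case 0
  then show ?case
    using assms(3) by (simp only: Ck_on.simps o_def) (rule continuous_on_compose2)
next
  case (Suc k)
  let ?D = "\<lambda>x v. \<Sum>b\<in>Basis. (frechet_derivative f (at x) v \<bullet> b) *\<^sub>R frechet_derivative g (at (f x)) b"
  show ?case
  proof (rule Ck_on_SucI[OF assms(1)])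
    show "((g \<circ> f) has_derivative ?D x) (at x)" if "x \<in> S" for x
    proof -
      have "f x \<in> T" using that assms(3) by blast
      then have g': "(g has_derivative frechet_derivative g (at (f x))) (at (f x))"
        by (rule Ck_on_Suc_has_derivative[OF Suc.prems(2)])
      interpret g': linear "frechet_derivative g (at (f x))"
        using g' by (rule has_derivative_linear)
      have "frechet_derivative g (at (f x)) y = (\<Sum>b\<in>Basis. (y \<bullet> b) *\<^sub>R frechet_derivative g (at (f x)) b)" for y
      proof -
        have "frechet_derivative g (at (f x)) (\<Sum>b\<in>Basis. (y \<bullet> b) *\<^sub>R b)
            = (\<Sum>b\<in>Basis. (y \<bullet> b) *\<^sub>R frechet_derivative g (at (f x)) b)"
          by (simp only: g'.sum g'.scaleR)
        then show ?thesis by (simp only: euclidean_representation)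
      qed
      then have "?D x = frechet_derivative g (at (f x)) \<circ> frechet_derivative f (at x)"
        unfolding o_def by (intro ext) (rule sym)
      then show ?thesis
        using diff_chain_at[OF Ck_on_Suc_has_derivative[OF Suc.prems(1) that] g'] by (simp only:)
    qed
    fix v
    have "Ck_on k S (\<lambda>x. frechet_derivative f (at x) v \<bullet> b)" for b
      using Suc.prems(1)
      by (intro Ck_on_bounded_linear_compose[OF assms(1) bounded_linear_inner_left]) simp
    moreover have "Ck_on k S (\<lambda>x. frechet_derivative g (at (f x)) b)" for b
      using Suc.IH[OF Ck_on_SucD[OF Suc.prems(1)], of "\<lambda>y. frechet_derivative g (at y) b"] Suc.prems(2)
      by (simp add: o_def)
    ultimately show "Ck_on k S (\<lambda>x. ?D x v)"
      by (intro Ck_on_sum Ck_on_scaleR assms(1)) auto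
  qed
qed

lemma smooth_on_line:
  fixes p v :: "'a::real_normed_vector"
  assumes "open S"
  shows "smooth_on S (\<lambda>t::real. p + t *\<^sub>R v)"
proof -
  have "Ck_on k S (\<lambda>t::real. p + t *\<^sub>R v)" for k
  proof (cases k)
    case 0
    then show ?thesis by (auto intro!: continuous_intros)
  next
    case (Suc l)
    have "Ck_on (Suc l) S (\<lambda>t::real. p + t *\<^sub>R v)"
      by (rule Ck_on_SucI[OF assms, where f' = "\<lambda>_ s. s *\<^sub>R v"])
        (auto intro!: derivative_eq_intros Ck_on_const assms)
    then show ?thesis using Suc by simp
  qed
  then show ?thesis by (simp add: smooth_on_def)
qed

section \<open>Symmetry of second derivatives\<close>

lemma DERIV_along_line:
  fixes f :: "'a::real_normed_vector \<Rightarrow> real"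
  assumes "f differentiable (at (p + s *\<^sub>R v))"
  shows "DERIV (\<lambda>s. f (p + s *\<^sub>R v)) s :> frechet_derivative f (at (p + s *\<^sub>R v)) v"
proof -
  have f': "(f has_derivative frechet_derivative f (at (p + s *\<^sub>R v))) (at (p + s *\<^sub>R v))"
    using assms by (simp add: frechet_derivative_works)
  have "((\<lambda>s. p + s *\<^sub>R v) has_derivative (\<lambda>t. t *\<^sub>R v)) (at s)"
    by (auto intro!: derivative_eq_intros)
  from diff_chain_at[OF this f'] show ?thesis
    using has_derivative_linear[OF f']
    by (simp add: has_field_derivative_def o_def linear_cmul mult.commute[of _ "frechet_derivative f (at (p + s *\<^sub>R v)) v"])
qed

text \<open>The mean value theorem is applied twice, first along \<open>a\<close> to the increment of \<open>f\<close> along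
  \<open>b\<close>, then along \<open>b\<close> to the derivative of \<open>f\<close> in the direction \<open>a\<close>. The left-hand side is symmetric
  in \<open>a\<close> and \<open>b\<close>, which gives the symmetry of second derivatives below.\<close>

lemma second_difference_eq_second_derivative:
  fixes f :: "'a::real_normed_vector \<Rightarrow> real"
  assumes f: "\<And>y. y \<in> ball x r \<Longrightarrow> f differentiable (at y)"
    and fa: "\<And>y. y \<in> ball x r \<Longrightarrow> (\<lambda>z. frechet_derivative f (at z) a) differentiable (at y)"
    and h: "0 < h" "h * (norm a + norm b) < r"
  shows "\<exists>y\<in>ball x r. f (x + h *\<^sub>R a + h *\<^sub>R b) - f (x + h *\<^sub>R a) - f (x + h *\<^sub>R b) + f x
     = h * h * frechet_derivative (\<lambda>z. frechet_derivative f (at z) a) (at y) b"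
proof -
  define D where "D y = frechet_derivative f (at y) a" for y
  have in_ball: "x + s *\<^sub>R a + t *\<^sub>R b \<in> ball x r" if "0 \<le> s" "s \<le> h" "0 \<le> t" "t \<le> h" for s t
  proof -
    have "norm (s *\<^sub>R a + t *\<^sub>R b) \<le> s * norm a + t * norm b"
      using norm_triangle_ineq[of "s *\<^sub>R a" "t *\<^sub>R b"] that by simp
    also have "\<dots> \<le> h * norm a + h * norm b"
      using that by (intro add_mono mult_right_mono) auto
    also have "\<dots> < r" using h by (simp add: algebra_simps)
    finally show ?thesis
      by (simp add: dist_norm add.assoc norm_minus_commute[of x] del: minus_add_distrib)
  qed
  have line: "DERIV (\<lambda>s. f (x + s *\<^sub>R a + t *\<^sub>R b)) s :> D (x + s *\<^sub>R a + t *\<^sub>R b)"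
    if "0 \<le> s" "s \<le> h" "0 \<le> t" "t \<le> h" for s t
    using DERIV_along_line[of f "x + t *\<^sub>R b" s a] f[OF in_ball[OF that]]
    by (simp add: D_def add.assoc add.commute[of "t *\<^sub>R b"])
  define F where "F s = f (x + s *\<^sub>R a + h *\<^sub>R b) - f (x + s *\<^sub>R a)" for s
  have "DERIV F s :> D (x + s *\<^sub>R a + h *\<^sub>R b) - D (x + s *\<^sub>R a)" if "0 \<le> s" "s \<le> h" for s
    unfolding F_def using line[OF that, of h] line[OF that, of 0] h
    by (intro DERIV_diff) auto
  from MVT2[OF h(1) this] obtain s where s: "0 < s" "s < h"
    and Fs: "F h - F 0 = h * (D (x + s *\<^sub>R a + h *\<^sub>R b) - D (x + s *\<^sub>R a))"
    by auto
  have "DERIV (\<lambda>t. D (x + s *\<^sub>R a + t *\<^sub>R b)) t :> frechet_derivative D (at (x + s *\<^sub>R a + t *\<^sub>R b)) b"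
    if "0 \<le> t" "t \<le> h" for t
    using fa[OF in_ball[of s t]] s that by (intro DERIV_along_line) (simp add: D_def[abs_def])
  from MVT2[OF h(1) this] obtain t where t: "0 < t" "t < h"
    and Dt: "D (x + s *\<^sub>R a + h *\<^sub>R b) - D (x + s *\<^sub>R a)
        = h * frechet_derivative D (at (x + s *\<^sub>R a + t *\<^sub>R b)) b"
    by auto
  have "F h - F 0 = h * h * frechet_derivative D (at (x + s *\<^sub>R a + t *\<^sub>R b)) b"
    by (simp add: Fs Dt)
  moreover have "F h - F 0 = f (x + h *\<^sub>R a + h *\<^sub>R b) - f (x + h *\<^sub>R a) - f (x + h *\<^sub>R b) + f x"
    by (simp add: F_def)
  ultimately show ?thesis
    using in_ball[of s t] s t by (intro bexI[of _ "x + s *\<^sub>R a + t *\<^sub>R b"]) (simp_all add: D_def[abs_def])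
qed

lemma second_derivative_symmetric_real:
  fixes f :: "'a::real_normed_vector \<Rightarrow> real"
  assumes "open S" "x \<in> S" and C2: "Ck_on (Suc (Suc 0)) S f"
  shows "frechet_derivative (\<lambda>z. frechet_derivative f (at z) a) (at x) b
    = frechet_derivative (\<lambda>z. frechet_derivative f (at z) b) (at x) a" (is "?L x = ?R x")
proof -
  have "\<bar>?L x - ?R x\<bar> \<le> e" if "e > 0" for e
  proof -
    have near: "\<forall>\<^sub>F y in nhds x. dist (F y) (F x) < e/2" if "continuous_on S F" for F :: "'a \<Rightarrow> real"
    proof -
      have "(F \<longlongrightarrow> F x) (nhds x)"
        using that \<open>open S\<close> \<open>x \<in> S\<close>
        by (simp add: continuous_on_eq_continuous_at isCont_def tendsto_at_iff_tendsto_nhds)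
      then show ?thesis
        by (rule tendstoD) (use \<open>e > 0\<close> in simp)
    qed
    have "continuous_on S ?L" "continuous_on S ?R"
      using C2 by simp_all
    from this[THEN near] eventually_nhds_in_open[OF \<open>open S\<close> \<open>x \<in> S\<close>]
    have "\<forall>\<^sub>F y in nhds x. dist (?L y) (?L x) < e/2 \<and> dist (?R y) (?R x) < e/2 \<and> y \<in> S"
      by (intro eventually_conj)
    then obtain r where r: "r > 0" and near: "\<And>y. dist y x < r \<Longrightarrow>
        dist (?L y) (?L x) < e/2 \<and> dist (?R y) (?R x) < e/2 \<and> y \<in> S"
      unfolding eventually_nhds_metric by auto
    \<comment> \<open>the side of the parallelogram spanned by \<open>h a\<close> and \<open>h b\<close>, small enough to stay in the ball\<close>
    define h where "h = r / (norm a + norm b + 1)"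
    have pos: "norm a + norm b + 1 > 0"
      by (simp add: add_nonneg_pos)
    then have h: "h > 0" "h * (norm a + norm b) < r"
      using r by (simp_all add: h_def field_simps)
    have ball: "y \<in> S" if "y \<in> ball x r" for y
      using near[of y] that by (simp add: dist_commute)
    have diff: "f differentiable (at y)" "(\<lambda>z. frechet_derivative f (at z) v) differentiable (at y)"
      if "y \<in> ball x r" for y v
      using C2 ball[OF that] by simp_all
    obtain y where y: "y \<in> ball x r" and
      Ly: "f (x + h *\<^sub>R a + h *\<^sub>R b) - f (x + h *\<^sub>R a) - f (x + h *\<^sub>R b) + f x = h * h * ?L y"
      using second_difference_eq_second_derivative[of x r f a h b] diff h by blast
    obtain z where z: "z \<in> ball x r" and
      Rz: "f (x + h *\<^sub>R b + h *\<^sub>R a) - f (x + h *\<^sub>R b) - f (x + h *\<^sub>R a) + f x = h * h * ?R z"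
      using second_difference_eq_second_derivative[of x r f b h a] diff h
      unfolding add.commute[of "norm b"] by blast
    have "h * h * ?L y = h * h * ?R z"
      unfolding Ly[symmetric] Rz[symmetric] by (simp add: algebra_simps)
    then have "?L y = ?R z" using h by simp
    moreover have "dist (?L y) (?L x) < e/2" "dist (?R z) (?R x) < e/2"
      using near[of y] near[of z] y z by (simp_all add: dist_commute)
    ultimately show ?thesis
      unfolding dist_real_def by linarith
  qed
  then have "\<bar>?L x - ?R x\<bar> \<le> 0"
    by (rule field_le_epsilon) simp
  then show ?thesis by simp
qed


lemma second_derivative_symmetric:
  fixes f :: "'a::real_normed_vector \<Rightarrow> 'b::euclidean_space"
  assumes "open S" "x \<in> S" and C2: "Ck_on (Suc (Suc 0)) S f"
  shows "frechet_derivative (\<lambda>z. frechet_derivative f (at z) a) (at x) b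
    = frechet_derivative (\<lambda>z. frechet_derivative f (at z) b) (at x) a"
proof (rule euclidean_eqI)
  fix c :: 'b
  have comp: "frechet_derivative (\<lambda>z. h z \<bullet> c) (at y) v = frechet_derivative h (at y) v \<bullet> c"
    if "h differentiable (at y)" for h :: "'a \<Rightarrow> 'b" and y v
  proof -
    have "((\<lambda>z. h z \<bullet> c) has_derivative (\<lambda>v. frechet_derivative h (at y) v \<bullet> c)) (at y)"
      using that unfolding frechet_derivative_works by (rule has_derivative_inner_left)
    from frechet_derivative_at[OF this] show ?thesis by metis
  qed
  have f: "f differentiable (at y)" "(\<lambda>z. frechet_derivative f (at z) v) differentiable (at y)"
    if "y \<in> S" for y v
    using C2 that by simp_all
  have second: "frechet_derivative (\<lambda>z. frechet_derivative (\<lambda>z. f z \<bullet> c) (at z) v) (at x) v'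
      = frechet_derivative (\<lambda>z. frechet_derivative f (at z) v) (at x) v' \<bullet> c" for v v'
  proof -
    have "frechet_derivative (\<lambda>z. frechet_derivative f (at z) v \<bullet> c) (at x)
        = frechet_derivative (\<lambda>z. frechet_derivative (\<lambda>z. f z \<bullet> c) (at z) v) (at x)"
    proof (rule frechet_derivative_transform_within_open[OF _ assms(1,2)])
      show "(\<lambda>z. frechet_derivative f (at z) v \<bullet> c) differentiable (at x)"
        using f(2)[OF assms(2)] by (intro differentiable_inner) auto
      show "frechet_derivative f (at z) v \<bullet> c = frechet_derivative (\<lambda>z. f z \<bullet> c) (at z) v"
        if "z \<in> S" for z
        by (rule comp[OF f(1)[OF that], symmetric])
    qed
    then show ?thesis
      by (simp only: comp[OF f(2)[OF assms(2)], symmetric])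
  qed
  have "Ck_on (Suc (Suc 0)) S (\<lambda>z. f z \<bullet> c)"
    by (rule Ck_on_bounded_linear_compose[OF assms(1) bounded_linear_inner_left C2])
  from second_derivative_symmetric_real[OF assms(1,2) this, of a b]
  show "frechet_derivative (\<lambda>z. frechet_derivative f (at z) a) (at x) b \<bullet> c
      = frechet_derivative (\<lambda>z. frechet_derivative f (at z) b) (at x) a \<bullet> c"
    by (simp only: second)
qed

section \<open>Differentiating determinants and inverse matrices\<close>

lemma pd_eqI: "(f has_derivative f') (at x) \<Longrightarrow> pd i f x = f' (axis i 1)"
  unfolding pd_def using frechet_derivative_at by metis

lemma has_derivative_det_expansion:
  fixes B :: "'a::real_normed_vector \<Rightarrow> real^'m^'m"
  assumes "\<And>i j. ((\<lambda>z. B z $ i $ j) has_derivative B' i j) (at x)"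
  shows "((\<lambda>z. det (B z)) has_derivative (\<lambda>h. \<Sum>p | p permutes UNIV. of_int (sign p) *
           (\<Sum>i\<in>UNIV. B' i (p i) h * (\<Prod>j\<in>UNIV-{i}. B x $ j $ p j)))) (at x)"
  unfolding det_def
  by (intro has_derivative_sum has_derivative_mult_right has_derivative_prod assms)

text \<open>A permutation other than the identity moves at least two indices, so each product of
  the expansion keeps an off-diagonal entry of the identity matrix after one factor has been
  differentiated. Only the trace survives.\<close>

lemma has_derivative_det_at_identity:
  fixes B :: "'a::real_normed_vector \<Rightarrow> real^'m^'m"
  assumes "\<And>i j. ((\<lambda>z. B z $ i $ j) has_derivative B' i j) (at x)" and "B x = mat 1"
  shows "((\<lambda>z. det (B z)) has_derivative (\<lambda>h. \<Sum>i\<in>UNIV. B' i i h)) (at x)"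
proof -
  have "(\<Sum>p | p permutes (UNIV::'m set). of_int (sign p) *
      (\<Sum>i\<in>UNIV. B' i (p i) h * (\<Prod>j\<in>UNIV-{i}. B x $ j $ p j))) = (\<Sum>i\<in>UNIV. B' i i h)"
    (is "sum ?t ?P = _") for h
  proof -
    have "?t p = 0" if "p \<in> ?P - {id}" for p
    proof -
      have "(\<Prod>j\<in>UNIV-{i}. B x $ j $ p j) = 0" for i
      proof -
        have "\<exists>j. j \<noteq> i \<and> p j \<noteq> j"
        proof (rule ccontr)
          assume nomove: "\<not> (\<exists>j. j \<noteq> i \<and> p j \<noteq> j)"
          have "inj p" using that permutes_inj by auto
          then have "p i = i" using nomove by (metis injD)
          then have "p = id" using nomove by (auto simp: fun_eq_iff)
          then show False using that by simp
        qed
        then obtain j where "j \<noteq> i" "p j \<noteq> j" by blast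
        then show ?thesis
          by (intro prod_zero) (auto simp: assms(2) mat_def intro!: bexI[of _ j])
      qed
      then show ?thesis by (simp only: mult_zero_right sum.neutral_const)
    qed
    then have "sum ?t ?P = sum ?t {id}"
      by (intro sum.mono_neutral_right) (auto simp: permutes_id)
    also have "\<dots> = (\<Sum>i\<in>UNIV. B' i i h)"
      by (simp add: sign_id assms(2) mat_def)
    finally show ?thesis .
  qed
  with has_derivative_det_expansion[OF assms(1)] show ?thesis by simp
qed

lemma matrix_inv_cancel:
  fixes A :: "real^'m^'m"
  assumes "det A \<noteq> 0"
  shows "A ** matrix_inv A = mat 1" "matrix_inv A ** A = mat 1"
proof -
  have "\<exists>B. A ** B = mat 1 \<and> B ** A = mat 1"
    using assms by (simp add: invertible_det_nz[symmetric] invertible_def)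
  from someI_ex[OF this] show "A ** matrix_inv A = mat 1" "matrix_inv A ** A = mat 1"
    by (simp_all add: matrix_inv_def)
qed

text \<open>The formula of Jacobi. Multiplying \<open>A\<close> by the constant matrix inverse to \<open>A x\<close> moves the
  base point to the identity.\<close>

lemma has_derivative_det:
  fixes A :: "'a::real_normed_vector \<Rightarrow> real^'m^'m"
  assumes "\<And>i j. ((\<lambda>z. A z $ i $ j) has_derivative A' i j) (at x)" and "det (A x) \<noteq> 0"
  shows "((\<lambda>z. det (A z)) has_derivative
    (\<lambda>h. det (A x) * (\<Sum>i\<in>UNIV. \<Sum>j\<in>UNIV. matrix_inv (A x) $ i $ j * A' j i h))) (at x)"
proof -
  define V where "V = matrix_inv (A x)"
  have V: "V ** A x = mat 1" "A x ** V = mat 1"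
    using matrix_inv_cancel[OF assms(2)] by (simp_all add: V_def)
  have "((\<lambda>z. (V ** A z) $ i $ k) has_derivative (\<lambda>h. \<Sum>j\<in>UNIV. V $ i $ j * A' j k h)) (at x)" for i k
    unfolding matrix_matrix_mult_def vec_lambda_beta
    by (intro has_derivative_sum has_derivative_mult_right assms(1))
  from has_derivative_mult_right[OF has_derivative_det_at_identity[OF this V(1)], of "det (A x)"]
  have "((\<lambda>z. det (A x) * det (V ** A z)) has_derivative
      (\<lambda>h. det (A x) * (\<Sum>i\<in>UNIV. \<Sum>j\<in>UNIV. V $ i $ j * A' j i h))) (at x)" .
  moreover have "det (A x) * det (V ** A z) = det (A z)" for z
  proof -
    have "det (A x) * det V = 1"
      using V(2) by (metis det_I det_mul)
    then show ?thesis by (simp add: det_mul mult.assoc[symmetric])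
  qed
  ultimately show ?thesis by (simp add: V_def)
qed

lemma differentiable_det:
  fixes A :: "'a::real_normed_vector \<Rightarrow> real^'m^'m"
  assumes "\<And>i j. (\<lambda>z. A z $ i $ j) differentiable (at x)"
  shows "(\<lambda>z. det (A z)) differentiable (at x)"
  using has_derivative_det_expansion[of A "\<lambda>i j. frechet_derivative (\<lambda>z. A z $ i $ j) (at x)" x] assms
  by (intro differentiableI) (simp add: frechet_derivative_works)

text \<open>By the rule of Cramer each entry of the inverse is a quotient of determinants; \<open>N\<close> below is
  the numerator matrix.\<close>

lemma differentiable_matrix_inv:
  fixes A :: "'a::real_normed_vector \<Rightarrow> real^'m^'m"
  assumes "open S" "x \<in> S" and A: "\<And>i j. (\<lambda>z. A z $ i $ j) differentiable (at x)"
    and det: "\<And>z. z \<in> S \<Longrightarrow> det (A z) \<noteq> 0"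
  shows "(\<lambda>z. matrix_inv (A z) $ i $ j) differentiable (at x)"
proof -
  define N where "N z = (\<chi> a c. if c = i then axis j 1 $ a else A z $ a $ c)" for z
  have "(\<lambda>z. N z $ a $ c) differentiable (at x)" for a c
    using A by (cases "c = i") (simp_all add: N_def)
  then have "(\<lambda>z. det (N z) / det (A z)) differentiable (at x)"
    using det[OF assms(2)] A by (intro differentiable_divide differentiable_det)
  moreover have "det (N z) / det (A z) = matrix_inv (A z) $ i $ j" if "z \<in> S" for z
  proof -
    have "A z *v (matrix_inv (A z) *v axis j 1) = axis j 1"
      by (simp add: matrix_vector_mul_assoc matrix_inv_cancel[OF det[OF that]])
    then have "matrix_inv (A z) *v axis j 1
        = (\<chi> k. det (\<chi> a c. if c = k then axis j 1 $ a else A z $ a $ c) / det (A z))"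
      by (simp add: cramer[OF det[OF that]])
    then show ?thesis
      by (simp add: N_def vec_eq_iff matrix_vector_mult_basis column_def)
  qed
  ultimately show ?thesis
    unfolding differentiable_def
    by (blast intro: has_derivative_transform_within_open[OF _ assms(1,2)])
qed

text \<open>The real square root is extended to negative numbers as an odd function, which makes one
  formula valid for both signs of \<open>d\<close>.\<close>

lemma DERIV_sqrt_nonzero:
  assumes "d \<noteq> 0"
  shows "DERIV sqrt d :> sqrt d / (2 * d)"
proof -
  have "sqrt d * sqrt d = \<bar>d\<bar>" by (rule real_sqrt_mult_self)
  then have "d > 0 \<Longrightarrow> sqrt d / (2 * d) = inverse (sqrt d) / 2"
    and "d < 0 \<Longrightarrow> sqrt d / (2 * d) = - inverse (sqrt d) / 2"
    using assms by (simp_all add: field_simps)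
  then show ?thesis
    by (rule DERIV_real_sqrt_generic[OF assms])
qed

text \<open>The divergence of \<open>Y\<close> in coordinates: the weight contributes half the logarithmic derivative
  of \<open>det g\<close>, which is the trace of the inverse of \<open>g\<close> times the derivative of \<open>g\<close>.\<close>

lemma divergence_formula:
  fixes g :: "real^'p \<Rightarrow> real^'p^'p" and Y :: "'p \<Rightarrow> real^'p \<Rightarrow> real"
  assumes g: "\<And>i j. (\<lambda>z. g z $ i $ j) differentiable (at w)"
    and det: "det (g w) \<noteq> 0" and Y: "\<And>i. Y i differentiable (at w)"
  shows "1 / sqrt (det (g w)) * (\<Sum>i\<in>UNIV. pd i (\<lambda>z. sqrt (det (g z)) * Y i z) w)
    = (\<Sum>i\<in>UNIV. pd i (Y i) w + 1/2 * Y i w *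
        (\<Sum>j\<in>UNIV. \<Sum>k\<in>UNIV. matrix_inv (g w) $ j $ k * pd i (\<lambda>z. g z $ k $ j) w))"
proof -
  define d where "d = det (g w)"
  have "1 / sqrt d * pd i (\<lambda>z. sqrt (det (g z)) * Y i z) w = pd i (Y i) w + 1/2 * Y i w *
        (\<Sum>j\<in>UNIV. \<Sum>k\<in>UNIV. matrix_inv (g w) $ j $ k * pd i (\<lambda>z. g z $ k $ j) w)" (is "_ = _ + 1/2 * _ * ?T") for i
  proof -
    let ?g' = "\<lambda>j k. frechet_derivative (\<lambda>z. g z $ j $ k) (at w)"
    let ?D = "\<lambda>h. d * (\<Sum>j\<in>UNIV. \<Sum>k\<in>UNIV. matrix_inv (g w) $ j $ k * ?g' k j h)"
    have "((\<lambda>z. det (g z)) has_derivative ?D) (at w)"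
      unfolding d_def using g det by (intro has_derivative_det) (simp_all add: frechet_derivative_works)
    moreover have "(sqrt has_derivative (*) (sqrt d / (2 * d))) (at (det (g w)))"
      using DERIV_sqrt_nonzero[OF det] by (simp add: has_field_derivative_def d_def)
    ultimately have "((\<lambda>z. sqrt (det (g z))) has_derivative (\<lambda>h. sqrt d / (2 * d) * ?D h)) (at w)"
      using diff_chain_at by (fastforce simp: o_def)
    moreover have "(Y i has_derivative frechet_derivative (Y i) (at w)) (at w)"
      using Y by (simp add: frechet_derivative_works)
    ultimately have "((\<lambda>z. sqrt (det (g z)) * Y i z) has_derivative
        (\<lambda>h. sqrt d * frechet_derivative (Y i) (at w) h + sqrt d / (2 * d) * ?D h * Y i w)) (at w)"
      unfolding d_def by (rule has_derivative_mult)
    from pd_eqI[OF this, of i]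
    have "pd i (\<lambda>z. sqrt (det (g z)) * Y i z) w = sqrt d * pd i (Y i) w + sqrt d / (2 * d) * (d * ?T) * Y i w"
      by (simp add: pd_def)
    then show ?thesis
      using det by (simp add: d_def field_simps)
  qed
  then show ?thesis
    by (simp add: sum_distrib_left d_def)
qed

section \<open>Gram matrices and orthogonal projection\<close>

lemma orth_proj_eqI:
  assumes "subspace V" "y \<in> V" "\<And>v. v \<in> V \<Longrightarrow> orthogonal (x - y) v"
  shows "orth_proj V x = y"
  unfolding orth_proj_def
proof (rule the_equality)
  show "y \<in> V \<and> (\<forall>v\<in>V. orthogonal (x - y) v)"
    using assms by blast
  fix y' assume y': "y' \<in> V \<and> (\<forall>v\<in>V. orthogonal (x - y') v)"
  then have "y' - y \<in> V"
    using assms by (simp add: subspace_diff)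
  then have "(x - y) \<bullet> (y' - y) = 0" "(x - y') \<bullet> (y' - y) = 0"
    using assms(3) y' by (auto simp: orthogonal_def)
  then have "(y' - y) \<bullet> (y' - y) = 0"
    by (simp add: inner_diff_left)
  then show "y' = y" by simp
qed

definition gram_matrix :: "('p::finite \<Rightarrow> real^'n) \<Rightarrow> real^'p^'p" where
  "gram_matrix e = (\<chi> i j. e i \<bullet> e j)"

lemma linear_eq_sum_axis:
  fixes L :: "real^'p \<Rightarrow> 'b::real_vector"
  assumes "linear L"
  shows "L x = (\<Sum>i\<in>UNIV. x $ i *\<^sub>R L (axis i 1))"
proof -
  interpret linear L by fact
  have "L (\<Sum>i\<in>UNIV. x $ i *\<^sub>R axis i 1) = (\<Sum>i\<in>UNIV. x $ i *\<^sub>R L (axis i 1))"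
    by (simp only: sum scaleR)
  then show ?thesis
    using basis_expansion[of x] by (simp add: scalar_mult_eq_scaleR)
qed

lemma range_linear_eq_span:
  fixes L :: "real^'p \<Rightarrow> real^'n"
  assumes "linear L"
  shows "range L = span (range (\<lambda>i. L (axis i 1)))"
proof
  show "range L \<subseteq> span (range (\<lambda>i. L (axis i 1)))"
  proof
    fix y assume "y \<in> range L"
    then obtain x where "y = L x" by blast
    then show "y \<in> span (range (\<lambda>i. L (axis i 1)))"
      by (simp add: linear_eq_sum_axis[OF assms, of x] span_sum span_mul span_base)
  qed
  show "span (range (\<lambda>i. L (axis i 1))) \<subseteq> range L"
    by (intro span_minimal linear_subspace_image[OF assms]) auto
qed

text \<open>A vector \<open>x\<close> in the kernel of the Gram matrix satisfies \<open>L x \<bullet> L x = 0\<close>.\<close>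

lemma det_gram_matrix_nonzero:
  fixes L :: "real^'p \<Rightarrow> real^'n"
  assumes "linear L" "inj L"
  shows "det (gram_matrix (\<lambda>i. L (axis i 1))) \<noteq> 0"
proof -
  let ?g = "gram_matrix (\<lambda>i. L (axis i 1))"
  have "x = 0" if "?g *v x = 0" for x
  proof -
    have "L x \<bullet> L (axis i 1) = (?g *v x) $ i" for i
      by (subst linear_eq_sum_axis[OF assms(1)])
        (simp add: gram_matrix_def matrix_vector_mult_def inner_sum_left inner_sum_right inner_commute mult.commute)
    then have "L x \<bullet> L (axis i 1) = 0" for i
      using that by simp
    then have "L x \<bullet> L x = 0"
      by (subst (2) linear_eq_sum_axis[OF assms(1)]) (simp add: inner_sum_right)
    then show "x = 0"
      using assms by (simp add: linear_injective_0)
  qed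
  then have "\<exists>B. B ** ?g = mat 1"
    by (simp add: matrix_left_invertible_ker)
  then show ?thesis
    by (simp add: invertible_left_inverse[symmetric] invertible_det_nz)
qed

lemma matrix_inv_gram_contract:
  assumes "det (gram_matrix e) \<noteq> 0"
  shows "(\<Sum>j\<in>UNIV. matrix_inv (gram_matrix e) $ i $ j * (e j \<bullet> e k)) = (if i = k then 1 else 0)"
    and "(\<Sum>j\<in>UNIV. (e i \<bullet> e j) * matrix_inv (gram_matrix e) $ j $ k) = (if i = k then 1 else 0)"
  using matrix_inv_cancel[OF assms]
  by (simp_all add: vec_eq_iff matrix_matrix_mult_def mat_def gram_matrix_def)

lemma matrix_inv_gram_symmetric:
  assumes "det (gram_matrix e) \<noteq> 0"
  shows "matrix_inv (gram_matrix e) $ i $ j = matrix_inv (gram_matrix e) $ j $ i"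
proof -
  let ?g = "gram_matrix e"
  have tr: "transpose ?g = ?g"
    by (simp add: transpose_def gram_matrix_def vec_eq_iff inner_commute)
  have "transpose (matrix_inv ?g) ** ?g = mat 1"
    using arg_cong[OF matrix_inv_cancel(1)[OF assms], of transpose]
    by (simp add: matrix_transpose_mul tr)
  moreover have "transpose (matrix_inv ?g) ** (?g ** matrix_inv ?g)
      = (transpose (matrix_inv ?g) ** ?g) ** matrix_inv ?g"
    by (rule matrix_mul_assoc)
  ultimately have "transpose (matrix_inv ?g) = matrix_inv ?g"
    by (simp add: matrix_inv_cancel(1)[OF assms])
  then have "transpose (matrix_inv ?g) $ j $ i = matrix_inv ?g $ j $ i"
    by (rule arg_cong)
  then show ?thesis
    by (simp add: transpose_def)
qed

text \<open>The coefficients solve the normal equations, whose matrix is the Gram matrix.\<close>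

lemma orth_proj_span_gram:
  fixes e :: "'p::finite \<Rightarrow> real^'n"
  assumes "det (gram_matrix e) \<noteq> 0"
  shows "orth_proj (span (range e)) y
    = (\<Sum>i\<in>UNIV. (\<Sum>j\<in>UNIV. matrix_inv (gram_matrix e) $ i $ j * (y \<bullet> e j)) *\<^sub>R e i)"
proof (rule orth_proj_eqI)
  let ?G = "matrix_inv (gram_matrix e)"
  let ?c = "\<lambda>i. \<Sum>j\<in>UNIV. ?G $ i $ j * (y \<bullet> e j)"
  show "(\<Sum>i\<in>UNIV. ?c i *\<^sub>R e i) \<in> span (range e)"
    by (intro span_sum span_mul span_base) auto
  fix v assume "v \<in> span (range e)"
  then show "orthogonal (y - (\<Sum>i\<in>UNIV. ?c i *\<^sub>R e i)) v"
  proof (rule orthogonal_to_span)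
    fix v assume "v \<in> range e"
    then obtain k where v: "v = e k" by blast
    have "(\<Sum>i\<in>UNIV. ?c i *\<^sub>R e i) \<bullet> e k = (\<Sum>i\<in>UNIV. \<Sum>j\<in>UNIV. (e k \<bullet> e i) * ?G $ i $ j * (y \<bullet> e j))"
      by (simp add: inner_sum_left sum_distrib_left sum_distrib_right inner_commute[of "e k"] mult_ac)
    also have "\<dots> = (\<Sum>j\<in>UNIV. (\<Sum>i\<in>UNIV. (e k \<bullet> e i) * ?G $ i $ j) * (y \<bullet> e j))"
      by (subst sum.swap) (simp add: sum_distrib_right)
    also have "\<dots> = y \<bullet> e k"
      by (simp add: matrix_inv_gram_contract(2)[OF assms] if_distrib[of "\<lambda>t. t * _"] cong: if_cong)
    finally show "orthogonal (y - (\<Sum>i\<in>UNIV. ?c i *\<^sub>R e i)) v"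
      by (simp add: orthogonal_def v inner_diff_left)
  qed
qed simp


section \<open>The Laplacian of a restriction\<close>

lemma pd_cong:
  assumes "open S" "x \<in> S" "f differentiable (at x)" "\<And>z. z \<in> S \<Longrightarrow> f z = g z"
  shows "pd i f x = pd i g x"
  unfolding pd_def using frechet_derivative_transform_within_open[OF assms(3,1,2,4)] by (simp only:)

lemma pd_mult:
  fixes f g :: "real^'p \<Rightarrow> real"
  assumes "f differentiable (at x)" "g differentiable (at x)"
  shows "pd i (\<lambda>z. f z * g z) x = f x * pd i g x + pd i f x * g x"
  by (subst pd_eqI[OF has_derivative_mult[OF assms[unfolded frechet_derivative_works]]])
    (simp add: pd_def)

lemma pd_inner:
  fixes f g :: "real^'p \<Rightarrow> real^'n"
  assumes "f differentiable (at x)" "g differentiable (at x)"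
  shows "pd i (\<lambda>z. f z \<bullet> g z) x = f x \<bullet> pd i g x + pd i f x \<bullet> g x"
  by (subst pd_eqI[OF has_derivative_inner[OF assms[unfolded frechet_derivative_works]]])
    (simp add: pd_def)

lemma pd_sum:
  fixes f :: "'k \<Rightarrow> real^'p \<Rightarrow> real"
  assumes "\<And>k. k \<in> K \<Longrightarrow> f k differentiable (at x)"
  shows "pd i (\<lambda>z. \<Sum>k\<in>K. f k z) x = (\<Sum>k\<in>K. pd i (f k) x)"
proof -
  have "((\<lambda>z. \<Sum>k\<in>K. f k z) has_derivative (\<lambda>h. \<Sum>k\<in>K. frechet_derivative (f k) (at x) h)) (at x)"
    using assms by (intro has_derivative_sum) (simp add: frechet_derivative_works)
  from pd_eqI[OF this] show ?thesis by (simp add: pd_def)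
qed

lemma pd_component:
  fixes f :: "real^'p \<Rightarrow> real^'n"
  assumes "f differentiable (at x)"
  shows "pd i (\<lambda>z. f z $ l) x = pd i f x $ l"
  by (subst pd_eqI[OF bounded_linear.has_derivative[OF bounded_linear_vec_nth
        assms[unfolded frechet_derivative_works]]])
    (simp add: pd_def)

lemma pd_compose:
  fixes \<phi> :: "real^'p \<Rightarrow> real^'n" and v :: "real^'n \<Rightarrow> real"
  assumes "\<phi> differentiable (at z)" "v differentiable (at (\<phi> z))"
  shows "pd i (v \<circ> \<phi>) z = (\<Sum>l\<in>UNIV. pd l v (\<phi> z) * pd i \<phi> z $ l)"
proof -
  have "linear (frechet_derivative v (at (\<phi> z)))"
    using assms(2) by (rule linear_frechet_derivative)
  from linear_eq_sum_axis[OF this, of "pd i \<phi> z"]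
  have "frechet_derivative v (at (\<phi> z)) (pd i \<phi> z) = (\<Sum>l\<in>UNIV. pd l v (\<phi> z) * pd i \<phi> z $ l)"
    by (simp add: pd_def mult.commute)
  moreover have "pd i (v \<circ> \<phi>) z = frechet_derivative v (at (\<phi> z)) (pd i \<phi> z)"
    using pd_eqI[OF diff_chain_at[OF assms[unfolded frechet_derivative_works]]]
    by (simp add: pd_def)
  ultimately show ?thesis by simp
qed

definition grad :: "(real^'n \<Rightarrow> real) \<Rightarrow> real^'n \<Rightarrow> real^'n" where
  "grad u x = (\<chi> l. pd l u x)"

text \<open>The linear algebra behind the Laplacian of a restriction, at one point. Think of \<open>B i j\<close> as
  \<open>\<partial>\<^sub>i \<partial>\<^sub>j \<phi>\<close>, of \<open>D i k\<close> as \<open>\<partial>\<^sub>i Y\<^sub>k\<close>, and of \<open>key\<close> as the derivative \<open>\<partial>\<^sub>i\<close> of the equation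
  \<open>\<Sum>\<^sub>k g\<^sub>j\<^sub>k Y\<^sub>k = b\<^sub>j\<close> with \<open>c i j = \<partial>\<^sub>i b\<^sub>j\<close>. Contracting \<open>key\<close> with the inverse Gram matrix \<open>G\<close> gives
  three terms: the trace of \<open>D\<close>, the weight term of the divergence, and the pairing of
  \<open>\<Sum>\<^sub>k Y\<^sub>k e\<^sub>k\<close> with the trace of \<open>B\<close>.\<close>

lemma divergence_contraction:
  fixes e :: "'p::finite \<Rightarrow> real^'n" and B :: "'p \<Rightarrow> 'p \<Rightarrow> real^'n"
  defines "G \<equiv> matrix_inv (gram_matrix e)"
  assumes det: "det (gram_matrix e) \<noteq> 0" and sym: "\<And>i j. B i j = B j i"
    and key: "\<And>i j. (\<Sum>k\<in>UNIV. (e j \<bullet> B i k + B i j \<bullet> e k) * Y k + (e j \<bullet> e k) * D i k) = c i j"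
  shows "(\<Sum>i\<in>UNIV. D i i + 1/2 * Y i * (\<Sum>j\<in>UNIV. \<Sum>k\<in>UNIV. G $ j $ k * (e k \<bullet> B i j + B i k \<bullet> e j)))
    = (\<Sum>i\<in>UNIV. \<Sum>j\<in>UNIV. G $ i $ j * c i j)
      - (\<Sum>k\<in>UNIV. Y k *\<^sub>R e k) \<bullet> (\<Sum>i\<in>UNIV. \<Sum>j\<in>UNIV. G $ i $ j *\<^sub>R B i j)"
proof -
  have Gsym: "G $ i $ j = G $ j $ i" for i j
    unfolding G_def by (rule matrix_inv_gram_symmetric[OF det])
  define S where "S i = (\<Sum>j\<in>UNIV. \<Sum>k\<in>UNIV. G $ j $ k * (e k \<bullet> B i j))" for i
  \<comment> \<open>the two halves of the derivative of the metric agree after contraction with the symmetric \<open>G\<close>\<close>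
  have half: "(\<Sum>j\<in>UNIV. \<Sum>k\<in>UNIV. G $ j $ k * (e k \<bullet> B i j + B i k \<bullet> e j)) = 2 * S i" for i
  proof -
    have "(\<Sum>j\<in>UNIV. \<Sum>k\<in>UNIV. G $ j $ k * (B i k \<bullet> e j)) = S i"
      unfolding S_def by (subst sum.swap) (simp only: inner_commute[of "B i _"] Gsym)
    moreover have "(\<Sum>j\<in>UNIV. \<Sum>k\<in>UNIV. G $ j $ k * (e k \<bullet> B i j + B i k \<bullet> e j))
       = S i + (\<Sum>j\<in>UNIV. \<Sum>k\<in>UNIV. G $ j $ k * (B i k \<bullet> e j))"
      by (simp only: S_def distrib_left sum.distrib)
    ultimately show ?thesis by simp
  qed
  have tangential: "(\<Sum>i\<in>UNIV. \<Sum>j\<in>UNIV. G $ i $ j * (\<Sum>k\<in>UNIV. (B i j \<bullet> e k) * Y k))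
      = (\<Sum>k\<in>UNIV. Y k *\<^sub>R e k) \<bullet> (\<Sum>i\<in>UNIV. \<Sum>j\<in>UNIV. G $ i $ j *\<^sub>R B i j)"
    by (simp add: inner_sum_right) (simp add: inner_sum_left inner_commute[of "B _ _" "e _"] mult_ac)
  \<comment> \<open>symmetry of second derivatives turns the contracted term into the weight term\<close>
  have christoffel: "(\<Sum>i\<in>UNIV. \<Sum>j\<in>UNIV. G $ i $ j * (\<Sum>k\<in>UNIV. (e j \<bullet> B i k) * Y k))
      = (\<Sum>k\<in>UNIV. Y k * S k)"
  proof -
    have "(\<Sum>i\<in>UNIV. \<Sum>j\<in>UNIV. G $ i $ j * (\<Sum>k\<in>UNIV. (e j \<bullet> B i k) * Y k))
        = (\<Sum>i\<in>UNIV. \<Sum>j\<in>UNIV. \<Sum>k\<in>UNIV. Y k * (G $ i $ j * (e j \<bullet> B k i)))"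
      by (simp only: sum_distrib_left sym[of _ _] mult_ac)
    also have "\<dots> = (\<Sum>i\<in>UNIV. \<Sum>k\<in>UNIV. \<Sum>j\<in>UNIV. Y k * (G $ i $ j * (e j \<bullet> B k i)))"
      by (intro sum.cong refl sum.swap)
    also have "\<dots> = (\<Sum>k\<in>UNIV. \<Sum>i\<in>UNIV. \<Sum>j\<in>UNIV. Y k * (G $ i $ j * (e j \<bullet> B k i)))"
      by (rule sum.swap)
    finally show ?thesis
      by (simp only: S_def sum_distrib_left)
  qed
  have trace_D: "(\<Sum>i\<in>UNIV. \<Sum>j\<in>UNIV. G $ i $ j * (\<Sum>k\<in>UNIV. (e j \<bullet> e k) * D i k)) = (\<Sum>i\<in>UNIV. D i i)"
  proof -
    have "(\<Sum>j\<in>UNIV. G $ i $ j * (\<Sum>k\<in>UNIV. (e j \<bullet> e k) * D i k)) = D i i" for i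
    proof -
      have "(\<Sum>j\<in>UNIV. G $ i $ j * (\<Sum>k\<in>UNIV. (e j \<bullet> e k) * D i k))
          = (\<Sum>j\<in>UNIV. \<Sum>k\<in>UNIV. G $ i $ j * (e j \<bullet> e k) * D i k)"
        by (simp only: sum_distrib_left mult.assoc)
      also have "\<dots> = (\<Sum>k\<in>UNIV. \<Sum>j\<in>UNIV. G $ i $ j * (e j \<bullet> e k) * D i k)"
        by (rule sum.swap)
      also have "\<dots> = (\<Sum>k\<in>UNIV. (\<Sum>j\<in>UNIV. G $ i $ j * (e j \<bullet> e k)) * D i k)"
        by (simp only: sum_distrib_right)
      also have "\<dots> = (\<Sum>k\<in>UNIV. if i = k then D i k else 0)"
        unfolding G_def matrix_inv_gram_contract(1)[OF det] by (intro sum.cong refl) simp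
      finally show ?thesis by simp
    qed
    then show ?thesis by (simp only:)
  qed
  have "(\<Sum>i\<in>UNIV. \<Sum>j\<in>UNIV. G $ i $ j * c i j)
      = (\<Sum>i\<in>UNIV. \<Sum>j\<in>UNIV. G $ i $ j * (\<Sum>k\<in>UNIV. (e j \<bullet> B i k) * Y k))
      + (\<Sum>i\<in>UNIV. \<Sum>j\<in>UNIV. G $ i $ j * (\<Sum>k\<in>UNIV. (B i j \<bullet> e k) * Y k))
      + (\<Sum>i\<in>UNIV. \<Sum>j\<in>UNIV. G $ i $ j * (\<Sum>k\<in>UNIV. (e j \<bullet> e k) * D i k))"
    unfolding key[symmetric] by (simp only: distrib_right distrib_left sum.distrib)
  then have "(\<Sum>i\<in>UNIV. \<Sum>j\<in>UNIV. G $ i $ j * c i j) = (\<Sum>k\<in>UNIV. Y k * S k)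
      + (\<Sum>k\<in>UNIV. Y k *\<^sub>R e k) \<bullet> (\<Sum>i\<in>UNIV. \<Sum>j\<in>UNIV. G $ i $ j *\<^sub>R B i j) + (\<Sum>i\<in>UNIV. D i i)"
    by (simp only: tangential christoffel trace_D)
  then show ?thesis
    unfolding half by (simp add: sum.distrib)
qed

lemma tr_on_span_gram:
  fixes e :: "'p::finite \<Rightarrow> real^'n"
  assumes "det (gram_matrix e) \<noteq> 0"
  shows "tr_on (span (range e)) H
    = (\<Sum>i\<in>UNIV. \<Sum>j\<in>UNIV. matrix_inv (gram_matrix e) $ i $ j * (e i \<bullet> (H *v e j)))"
proof -
  let ?G = "matrix_inv (gram_matrix e)"
  have P: "matrix (orth_proj (span (range e))) $ m $ l
      = (\<Sum>i\<in>UNIV. \<Sum>j\<in>UNIV. ?G $ i $ j * e j $ l * e i $ m)" for m l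
    by (simp add: matrix_def orth_proj_span_gram[OF assms] inner_axis_axis inner_axis' sum_distrib_right)
  have "tr_on (span (range e)) H
      = (\<Sum>l\<in>UNIV. \<Sum>m\<in>UNIV. \<Sum>i\<in>UNIV. \<Sum>j\<in>UNIV. ?G $ i $ j * (e j $ l * (H $ l $ m * e i $ m)))"
    by (simp add: tr_on_def trace_def matrix_matrix_mult_def P sum_distrib_left mult_ac)
  also have "\<dots> = (\<Sum>l\<in>UNIV. \<Sum>i\<in>UNIV. \<Sum>m\<in>UNIV. \<Sum>j\<in>UNIV. ?G $ i $ j * (e j $ l * (H $ l $ m * e i $ m)))"
    by (intro sum.cong refl sum.swap)
  also have "\<dots> = (\<Sum>i\<in>UNIV. \<Sum>l\<in>UNIV. \<Sum>m\<in>UNIV. \<Sum>j\<in>UNIV. ?G $ i $ j * (e j $ l * (H $ l $ m * e i $ m)))"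
    by (rule sum.swap)
  also have "\<dots> = (\<Sum>i\<in>UNIV. \<Sum>l\<in>UNIV. \<Sum>j\<in>UNIV. \<Sum>m\<in>UNIV. ?G $ i $ j * (e j $ l * (H $ l $ m * e i $ m)))"
    by (intro sum.cong refl sum.swap)
  also have "\<dots> = (\<Sum>i\<in>UNIV. \<Sum>j\<in>UNIV. \<Sum>l\<in>UNIV. \<Sum>m\<in>UNIV. ?G $ i $ j * (e j $ l * (H $ l $ m * e i $ m)))"
    by (intro sum.cong refl sum.swap)
  also have "\<dots> = (\<Sum>i\<in>UNIV. \<Sum>j\<in>UNIV. ?G $ i $ j * (e j \<bullet> (H *v e i)))"
    by (simp add: inner_vec_def matrix_vector_mult_def sum_distrib_left)
  also have "\<dots> = (\<Sum>i\<in>UNIV. \<Sum>j\<in>UNIV. ?G $ i $ j * (e i \<bullet> (H *v e j)))"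
    by (subst sum.swap) (simp only: matrix_inv_gram_symmetric[OF assms])
  finally show ?thesis .
qed

lemma induced_metric_eq_gram_matrix: "induced_metric \<phi> z = gram_matrix (\<lambda>i. pd i \<phi> z)"
  by (simp add: induced_metric_def gram_matrix_def)

text \<open>The second summand is the pairing of \<open>\<nabla>u\<close> with the mean curvature vector, with the normal
  projection moved to the side of the gradient.\<close>

lemma laplace_beltrami_compose:
  fixes \<phi> :: "real^'p \<Rightarrow> real^'n" and u :: "real^'n \<Rightarrow> real"
  assumes W: "open W" "w \<in> W" and \<phi>: "Ck_on (Suc (Suc 0)) W \<phi>"
    and inj: "\<And>z. z \<in> W \<Longrightarrow> inj (frechet_derivative \<phi> (at z))"
    and u: "Ck_on (Suc (Suc 0)) X u" and X: "\<phi> ` W \<subseteq> X"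
  defines "T \<equiv> range (frechet_derivative \<phi> (at w))"
  shows "laplace_beltrami (induced_metric \<phi>) (u \<circ> \<phi>) w
    = tr_on T (hess u (\<phi> w))
      + (grad u (\<phi> w) - orth_proj T (grad u (\<phi> w))) \<bullet>
        (\<Sum>i\<in>UNIV. \<Sum>j\<in>UNIV. matrix_inv (induced_metric \<phi> w) $ i $ j *\<^sub>R pd i (pd j \<phi>) w)"
proof -
  define g where "g = induced_metric \<phi>"
  define e where "e i = pd i \<phi> w" for i
  define B where "B i j = pd i (pd j \<phi>) w" for i j
  define n where "n = grad u (\<phi> w)"
  define b where "b j z = (\<Sum>l\<in>UNIV. pd l u (\<phi> z) * pd j \<phi> z $ l)" for j z
  define Y where "Y i z = (\<Sum>j\<in>UNIV. matrix_inv (g z) $ i $ j * pd j (u \<circ> \<phi>) z)" for i z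
  have d\<phi>: "\<phi> differentiable (at z)" "pd i \<phi> differentiable (at z)" if "z \<in> W" for z i
    using \<phi> that by (simp_all add: pd_def[abs_def])
  have du: "u differentiable (at (\<phi> z))" "pd i u differentiable (at (\<phi> z))" if "z \<in> W" for z i
    using u X that by (auto simp: pd_def[abs_def])
  have g_w: "g w = gram_matrix e"
    by (simp add: g_def e_def[abs_def] induced_metric_eq_gram_matrix)
  have det: "det (g z) \<noteq> 0" if "z \<in> W" for z
    unfolding g_def induced_metric_eq_gram_matrix pd_def
    by (rule det_gram_matrix_nonzero[OF linear_frechet_derivative[OF d\<phi>(1)[OF that]] inj[OF that]])
  have g_entry: "g z $ i $ j = pd i \<phi> z \<bullet> pd j \<phi> z" for i j z
    by (simp add: g_def induced_metric_def)
  have dg: "(\<lambda>z. g z $ i $ j) differentiable (at w)" for i j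
    unfolding g_entry using d\<phi>(2)[OF W(2)] by (intro differentiable_inner)
  have pd_g: "pd i (\<lambda>z. g z $ j $ k) w = e j \<bullet> B i k + B i j \<bullet> e k" for i j k
    unfolding g_entry e_def B_def by (rule pd_inner[OF d\<phi>(2)[OF W(2)] d\<phi>(2)[OF W(2)]])
  have B_sym: "B i j = B j i" for i j
    unfolding B_def pd_def by (rule second_derivative_symmetric[OF W \<phi>])
  have grad_compose: "pd j (u \<circ> \<phi>) z = b j z" if "z \<in> W" for j z
    unfolding b_def by (rule pd_compose[OF d\<phi>(1)[OF that] du(1)[OF that]])
  have du_\<phi>: "(\<lambda>z. pd l u (\<phi> z)) differentiable (at w)" for l
    using differentiable_chain_at[OF d\<phi>(1)[OF W(2)] du(2)[OF W(2)]] by (simp add: o_def)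
  have d\<phi>_component: "(\<lambda>z. pd j \<phi> z $ l) differentiable (at w)" for j l
    by (rule differentiableI[OF bounded_linear.has_derivative[OF bounded_linear_vec_nth
          d\<phi>(2)[OF W(2), unfolded frechet_derivative_works]]])
  have db: "b j differentiable (at w)" for j
    unfolding b_def[abs_def] using du_\<phi> d\<phi>_component
    by (intro differentiable_sum differentiable_mult) auto
  have pd_b: "pd i (b j) w = e i \<bullet> (hess u (\<phi> w) *v e j) + n \<bullet> B i j" for i j
  proof -
    have "pd i (b j) w = (\<Sum>l\<in>UNIV. pd l u (\<phi> w) * pd i (\<lambda>z. pd j \<phi> z $ l) w
        + pd i (\<lambda>z. pd l u (\<phi> z)) w * e j $ l)"
      unfolding b_def[abs_def]
      by (subst pd_sum) (auto intro: differentiable_mult du_\<phi> d\<phi>_component simp: pd_mult du_\<phi> d\<phi>_component e_def)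
    also have "\<dots> = (\<Sum>l\<in>UNIV. n $ l * B i j $ l)
        + (\<Sum>l\<in>UNIV. \<Sum>m\<in>UNIV. e i $ m * (hess u (\<phi> w) $ m $ l * e j $ l))"
      using pd_compose[OF d\<phi>(1)[OF W(2)] du(2)[OF W(2)]] pd_component[OF d\<phi>(2)[OF W(2)]]
      by (simp add: sum.distrib n_def grad_def B_def hess_def o_def e_def sum_distrib_left mult_ac)
    also have "(\<Sum>l\<in>UNIV. \<Sum>m\<in>UNIV. e i $ m * (hess u (\<phi> w) $ m $ l * e j $ l)) = e i \<bullet> (hess u (\<phi> w) *v e j)"
      by (subst sum.swap) (simp add: inner_vec_def matrix_vector_mult_def sum_distrib_left)
    finally show ?thesis
      by (simp add: inner_vec_def)
  qed
  \<comment> \<open>the components \<open>Y i\<close> of the gradient are known to be differentiable, but their derivatives are only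
    accessible through the linear system \<open>gY\<close> that they solve\<close>
  have dY: "Y i differentiable (at w)" for i
  proof -
    have "(\<lambda>z. \<Sum>j\<in>UNIV. matrix_inv (g z) $ i $ j * b j z) differentiable (at w)"
      using differentiable_matrix_inv[OF W dg det] db
      by (intro differentiable_sum differentiable_mult) auto
    moreover have "(\<Sum>j\<in>UNIV. matrix_inv (g z) $ i $ j * b j z) = Y i z" if "z \<in> W" for z
      by (simp add: Y_def grad_compose[OF that])
    ultimately show ?thesis
      unfolding differentiable_def by (blast intro: has_derivative_transform_within_open[OF _ W])
  qed
  have gY: "(\<Sum>k\<in>UNIV. g z $ j $ k * Y k z) = b j z" if "z \<in> W" for j z
  proof -
    have "g z *v (matrix_inv (g z) *v (\<chi> i. b i z)) = (\<chi> i. b i z)"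
      by (simp add: matrix_vector_mul_assoc matrix_inv_cancel[OF det[OF that]])
    moreover have "matrix_inv (g z) *v (\<chi> i. b i z) = (\<chi> i. Y i z)"
      by (simp add: Y_def matrix_vector_mult_def grad_compose[OF that])
    ultimately show ?thesis
      by (simp add: vec_eq_iff matrix_vector_mult_def)
  qed
  have key: "(\<Sum>k\<in>UNIV. (e j \<bullet> B i k + B i j \<bullet> e k) * Y k w + (e j \<bullet> e k) * pd i (Y k) w)
      = e i \<bullet> (hess u (\<phi> w) *v e j) + n \<bullet> B i j" for i j
  proof -
    have "pd i (b j) w = pd i (\<lambda>z. \<Sum>k\<in>UNIV. g z $ j $ k * Y k z) w"
      by (rule pd_cong[OF W db]) (simp only: gY)
    also have "\<dots> = (\<Sum>k\<in>UNIV. pd i (\<lambda>z. g z $ j $ k * Y k z) w)"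
      by (intro pd_sum differentiable_mult dg dY)
    also have "\<dots> = (\<Sum>k\<in>UNIV. (e j \<bullet> e k) * pd i (Y k) w + (e j \<bullet> B i k + B i j \<bullet> e k) * Y k w)"
      by (simp only: pd_mult[OF dg dY] pd_g) (simp only: g_entry e_def)
    finally show ?thesis
      by (simp only: pd_b add.commute)
  qed
  have det_e: "det (gram_matrix e) \<noteq> 0"
    using det[OF W(2)] by (simp add: g_w)
  have T: "T = span (range e)"
    unfolding T_def e_def[abs_def] pd_def
    by (rule range_linear_eq_span[OF linear_frechet_derivative[OF d\<phi>(1)[OF W(2)]]])
  have proj: "orth_proj T n = (\<Sum>k\<in>UNIV. Y k w *\<^sub>R e k)"
    unfolding T orth_proj_span_gram[OF det_e] Y_def grad_compose[OF W(2)] g_w[symmetric] b_def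
    by (simp add: n_def grad_def inner_vec_def e_def)
  let ?G = "matrix_inv (gram_matrix e)"
  have "laplace_beltrami (induced_metric \<phi>) (u \<circ> \<phi>) w
      = 1 / sqrt (det (g w)) * (\<Sum>i\<in>UNIV. pd i (\<lambda>z. sqrt (det (g z)) * Y i z) w)"
    by (simp only: laplace_beltrami_def g_def[symmetric] Y_def)
  also have "\<dots> = (\<Sum>i\<in>UNIV. pd i (Y i) w + 1/2 * Y i w *
        (\<Sum>j\<in>UNIV. \<Sum>k\<in>UNIV. ?G $ j $ k * (e k \<bullet> B i j + B i k \<bullet> e j)))"
    unfolding g_w[symmetric] pd_g[symmetric] by (rule divergence_formula[OF dg det[OF W(2)] dY])
  also have "\<dots> = (\<Sum>i\<in>UNIV. \<Sum>j\<in>UNIV. ?G $ i $ j * (e i \<bullet> (hess u (\<phi> w) *v e j) + n \<bullet> B i j))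
      - (\<Sum>k\<in>UNIV. Y k w *\<^sub>R e k) \<bullet> (\<Sum>i\<in>UNIV. \<Sum>j\<in>UNIV. ?G $ i $ j *\<^sub>R B i j)"
    by (rule divergence_contraction[OF det_e B_sym key])
  also have "(\<Sum>i\<in>UNIV. \<Sum>j\<in>UNIV. ?G $ i $ j * (e i \<bullet> (hess u (\<phi> w) *v e j) + n \<bullet> B i j))
      = tr_on T (hess u (\<phi> w)) + n \<bullet> (\<Sum>i\<in>UNIV. \<Sum>j\<in>UNIV. ?G $ i $ j *\<^sub>R B i j)"
    unfolding T tr_on_span_gram[OF det_e]
    by (simp only: distrib_left sum.distrib inner_sum_right inner_scaleR_right)
  finally show ?thesis
    unfolding proj[symmetric]
    by (simp add: o_def inner_diff_left add_diff_eq n_def B_def g_w[symmetric] g_def)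
qed

lemma orth_proj_residual_inner:
  assumes "subspace T"
  shows "(x - orth_proj T x) \<bullet> y = x \<bullet> (y - orth_proj T y)"
proof -
  have proj: "orth_proj T z \<in> T \<and> (\<forall>v\<in>T. orthogonal (z - orth_proj T z) v)" for z
  proof -
    obtain y r where "y \<in> span T" "\<And>v. v \<in> span T \<Longrightarrow> orthogonal r v" "z = y + r"
      by (rule orthogonal_subspace_decomp_exists[of T z]) blast
    then have yr: "y \<in> T" "\<And>v. v \<in> T \<Longrightarrow> orthogonal (z - y) v"
      using assms by (auto simp: span_eq_iff[THEN iffD2])
    then show ?thesis
      using orth_proj_eqI[OF assms yr] by simp
  qed
  then have "(x - orth_proj T x) \<bullet> orth_proj T y = 0" "(y - orth_proj T y) \<bullet> orth_proj T x = 0"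
    by (auto simp: orthogonal_def)
  then show ?thesis
    by (simp add: inner_diff_left inner_diff_right inner_commute)
qed

section \<open>Tangent spaces and the theorem\<close>

lemma range_derivative_subset_tangent_space:
  fixes \<phi> :: "real^'p \<Rightarrow> real^'n"
  assumes \<phi>: "local_parametrization M W \<phi>" and w: "w \<in> W"
  shows "range (frechet_derivative \<phi> (at w)) \<subseteq> tangent_space M (\<phi> w)"
proof
  have W: "open W" and smooth: "smooth_on W \<phi>" and M: "\<phi> ` W \<subseteq> M"
    using \<phi> unfolding local_parametrization_def by (auto dest: openin_imp_subset)
  fix v assume "v \<in> range (frechet_derivative \<phi> (at w))"
  then obtain a where v: "v = frechet_derivative \<phi> (at w) a" by blast
  define line where "line t = w + t *\<^sub>R a" for t :: real
  have "open (line -` W)"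
    unfolding line_def[abs_def] by (intro open_vimage W continuous_intros)
  moreover have "0 \<in> line -` W"
    using w by (simp add: line_def)
  ultimately obtain \<epsilon> where \<epsilon>: "\<epsilon> > 0" "ball 0 \<epsilon> \<subseteq> line -` W"
    by (meson open_contains_ball)
  then have line_W: "line ` {-\<epsilon><..<\<epsilon>} \<subseteq> W"
    by (auto simp: ball_eq_greaterThanLessThan)
  have "smooth_on {-\<epsilon><..<\<epsilon>} (\<phi> \<circ> line)"
    using smooth smooth_on_line[of "{-\<epsilon><..<\<epsilon>}" w a] line_W
    unfolding smooth_on_def line_def[abs_def] by (blast intro: Ck_on_compose open_greaterThanLessThan)
  moreover have "(\<phi> \<circ> line) ` {-\<epsilon><..<\<epsilon>} \<subseteq> M"
    using line_W M by auto
  moreover have "((\<phi> \<circ> line) has_vector_derivative v) (at 0)"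
  proof -
    have "Ck_on (Suc 0) W \<phi>"
      using smooth by (simp only: smooth_on_def)
    then have \<phi>': "(\<phi> has_derivative frechet_derivative \<phi> (at w)) (at (line 0))"
      using w by (simp add: line_def frechet_derivative_works[symmetric])
    have "(line has_derivative (\<lambda>t. t *\<^sub>R a)) (at 0)"
      unfolding line_def[abs_def] by (auto intro!: derivative_eq_intros)
    from diff_chain_at[OF this \<phi>'] show ?thesis
      using has_derivative_linear[OF \<phi>']
      by (simp add: has_vector_derivative_def o_def v linear_cmul)
  qed
  moreover have "(\<phi> \<circ> line) 0 = \<phi> w"
    by (simp add: line_def)
  ultimately show "v \<in> tangent_space M (\<phi> w)"
    unfolding tangent_space_def using \<epsilon>(1) by blast
qed

text \<open>Both spaces have dimension \<open>p\<close>, so the inclusion above is an equality.\<close>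

lemma tangent_space_eq_range_derivative:
  fixes \<phi> :: "real^'p \<Rightarrow> real^'n"
  assumes \<phi>: "local_parametrization M W \<phi>" and w: "w \<in> W"
    and T: "tangent_space M (\<phi> w) \<in> grassmannian CARD('p)"
  shows "tangent_space M (\<phi> w) = range (frechet_derivative \<phi> (at w))"
proof -
  have smooth: "smooth_on W \<phi>" and inj: "inj (frechet_derivative \<phi> (at w))"
    using \<phi> w unfolding local_parametrization_def by auto
  have "Ck_on (Suc 0) W \<phi>"
    using smooth by (simp only: smooth_on_def)
  then have lin: "linear (frechet_derivative \<phi> (at w))"
    using w by (simp add: linear_frechet_derivative)
  have "dim (range (frechet_derivative \<phi> (at w))) = CARD('p)"
    using dim_image_eq[OF lin, of UNIV] inj by simp
  then show ?thesis
    using T range_derivative_subset_tangent_space[OF \<phi> w] linear_subspace_image[OF lin subspace_UNIV]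
    by (intro subspace_dim_equal[symmetric]) (simp_all add: grassmannian_def)
qed

theorem theorem2p2:
  fixes G :: "(real^'n) set set" and X M :: "(real^'n) set" and u :: "real^'n \<Rightarrow> real"
  assumes "CARD('p::finite) \<le> CARD('n)"
    and "G \<noteq> {}" and "closedin (grassmannian_topology CARD('p)) G"
    and "open X" and "connected X"
    and "M \<subseteq> X"
    and "G_submanifold TYPE('p) G M"
    and "minimal_submanifold TYPE('p) M"
    and "G_psh_on G X u"
  shows "subharmonic_on_submanifold TYPE('p) M u"
  unfolding subharmonic_on_submanifold_def
proof (intro allI impI conjI ballI)
  fix W and \<phi> :: "real^'p \<Rightarrow> real^'n"
  assume \<phi>: "local_parametrization M W \<phi>"
  have W: "open W" and \<phi>_smooth: "smooth_on W \<phi>" and \<phi>_M: "\<phi> ` W \<subseteq> M"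
    and inj: "\<And>z. z \<in> W \<Longrightarrow> inj (frechet_derivative \<phi> (at z))"
    using \<phi> unfolding local_parametrization_def by (auto dest: openin_imp_subset)
  have \<phi>_X: "\<phi> ` W \<subseteq> X"
    using \<phi>_M assms(6) by blast
  have u_smooth: "smooth_on X u" and psh: "\<And>x \<xi>. x \<in> X \<Longrightarrow> \<xi> \<in> G \<Longrightarrow> tr_on \<xi> (hess u x) \<ge> 0"
    using assms(9) by (auto simp: G_psh_on_def)
  show "smooth_on W (u \<circ> \<phi>)"
    using \<phi>_smooth u_smooth Ck_on_compose[OF W _ \<phi>_X] unfolding smooth_on_def by blast
  fix w assume w: "w \<in> W"
  define T where "T = tangent_space M (\<phi> w)"
  define n where "n = grad u (\<phi> w)"
  have "G \<subseteq> grassmannian CARD('p)"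
    using closedin_subset[OF assms(3)]
    by (auto simp: grassmannian_topology_def topspace_pullback_topology)
  moreover have T_G: "T \<in> G"
    using assms(7) \<phi>_M w by (auto simp: T_def G_submanifold_def)
  ultimately have T_grass: "T \<in> grassmannian CARD('p)"
    by blast
  then have T_range: "T = range (frechet_derivative \<phi> (at w))"
    unfolding T_def by (rule tangent_space_eq_range_derivative[OF \<phi> w])
  have T_subspace: "subspace T"
    using T_grass by (simp add: grassmannian_def)
  let ?G = "matrix_inv (induced_metric \<phi> w)"
  \<comment> \<open>\<open>n\<close> is the full gradient; the residual of the projection is moved from \<open>n\<close> to the second
    derivatives of \<open>\<phi>\<close>, which makes the second fundamental form appear\<close>
  have "(n - orth_proj T n) \<bullet> (\<Sum>i\<in>UNIV. \<Sum>j\<in>UNIV. ?G $ i $ j *\<^sub>R pd i (pd j \<phi>) w)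
      = (\<Sum>i\<in>UNIV. \<Sum>j\<in>UNIV. ?G $ i $ j * ((n - orth_proj T n) \<bullet> pd i (pd j \<phi>) w))"
    by (simp only: inner_sum_right inner_scaleR_right)
  also have "\<dots> = n \<bullet> mean_curvature M \<phi> w"
    unfolding mean_curvature_def second_fundamental_form_def T_def[symmetric]
    by (simp only: orth_proj_residual_inner[OF T_subspace] inner_sum_right inner_scaleR_right)
  also have "\<dots> = 0"
    using assms(8) \<phi> w by (simp add: minimal_submanifold_def)
  finally have normal_part:
    "(n - orth_proj T n) \<bullet> (\<Sum>i\<in>UNIV. \<Sum>j\<in>UNIV. ?G $ i $ j *\<^sub>R pd i (pd j \<phi>) w) = 0" .
  have C2: "Ck_on (Suc (Suc 0)) W \<phi>" "Ck_on (Suc (Suc 0)) X u"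
    using \<phi>_smooth u_smooth by (simp_all only: smooth_on_def)
  have "laplace_beltrami (induced_metric \<phi>) (u \<circ> \<phi>) w = tr_on T (hess u (\<phi> w))"
    using laplace_beltrami_compose[OF W w C2(1) inj C2(2) \<phi>_X] normal_part
    unfolding T_range n_def by simp
  also have "\<dots> \<ge> 0"
    using \<phi>_X w T_G by (intro psh) auto
  finally show "laplace_beltrami (induced_metric \<phi>) (u \<circ> \<phi>) w \<ge> 0" .
qed

end
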